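(* A nontrivial partial semilattice operation does not satisfy any absorption identities other than those following from idempotence.
   Context: A partial semilattice operation is an idempotent binary operation $s$ satisfying the identities $s(x,s(x,y)) \approx s(s(x,y),x) \approx s(x,y)$. It is nontrivial if it is not a projection. An absorption identity (in the language with the single binary operation symbol $s$) is an identity of the form $t(x_1,\dots,x_n) \approx x_i$, where $t$ is a term. An absorption identity follows from idempotence if it is a consequence of the identity $s(x,x) \approx x$. *)

theory Defs
  imports Main
begin

datatype trm = Var nat | App trm trm

datatype identity = Identity trm trm (infix "\<approx>" 50)

primrec eval :: "('a \<Rightarrow> 'a \<Rightarrow> 'a) \<Rightarrow> (nat \<Rightarrow> 'a) \<Rightarrow> trm \<Rightarrow> 'a" where
  "eval s \<rho> (Var i) = \<rho> i"
| "eval s \<rho> (App t u) = s (eval s \<rho> t) (eval s \<rho> u)"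

primrec satisfies :: "('a \<Rightarrow> 'a \<Rightarrow> 'a) \<Rightarrow> identity \<Rightarrow> bool" where
  "satisfies s (t \<approx> u) \<longleftrightarrow> (\<forall>\<rho>. eval s \<rho> t = eval s \<rho> u)"

definition partial_semilattice_op :: "('a \<Rightarrow> 'a \<Rightarrow> 'a) \<Rightarrow> bool" where
  "partial_semilattice_op s \<longleftrightarrow>
     (\<forall>x. s x x = x) \<and>
     (\<forall>x y. s x (s x y) = s x y \<and> s (s x y) x = s x y)"

definition projection :: "('a \<Rightarrow> 'a \<Rightarrow> 'a) \<Rightarrow> bool" where
  "projection s \<longleftrightarrow> s = (\<lambda>x y. x) \<or> s = (\<lambda>x y. y)"

definition absorption_identity :: "identity \<Rightarrow> bool" where
  "absorption_identity e \<longleftrightarrow> (\<exists>t i. e = (t \<approx> Var i))"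

definition idempotence :: identity where
  "idempotence = (App (Var 0) (Var 0) \<approx> Var 0)"

text \<open>
  Semantic consequence, restricted to the algebras whose universe is the type
  \<open>'b\<close>. HOL cannot quantify over types inside a definition, so consequence over
  all algebras is expressed by leaving \<open>'b\<close> a free type variable in a theorem's
  conclusion; it is independent of the type on which any hypothesis is stated.
\<close>

definition consequence :: "'b itself \<Rightarrow> identity \<Rightarrow> identity \<Rightarrow> bool" where
  "consequence (_ :: 'b itself) d e \<longleftrightarrow>
     (\<forall>s :: 'b \<Rightarrow> 'b \<Rightarrow> 'b. satisfies s d \<longrightarrow> satisfies s e)"

definition follows_from_idempotence :: "'b itself \<Rightarrow> identity \<Rightarrow> bool" where
  "follows_from_idempotence T e \<longleftrightarrow> consequence T idempotence e"

end

(* If s is not the first projection, some c = s(a,b) differs from a, and the identities make {a,c} a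
   subalgebra that is a two-element semilattice with absorbing element c. There a term takes
   the value a, when x_i is sent to a and all other variables to c, only if x_i is its sole variable;
   and a term in one variable collapses to that variable by idempotence. *)
theory Submission imports Defs begin

primrec vars :: "trm \<Rightarrow> nat set" where
  "vars (Var i) = {i}"
| "vars (App t u) = vars t \<union> vars u"

lemma satisfies_idempotence_iff: "satisfies s idempotence \<longleftrightarrow> (\<forall>x. s x x = x)"
  unfolding idempotence_def by (auto dest: spec[where x = "\<lambda>_. x" for x])

lemma eval_idempotent:
  assumes "\<And>x. s x x = x" and "vars t \<subseteq> {i}"
  shows "eval s \<rho> t = \<rho> i"
  using assms(2) by (induction t) (simp_all add: assms(1))

text \<open>As \<open>c\<close> absorbs, an \<open>App\<close> takes the value \<open>a\<close> only
  if both arguments do, which matches the union in \<open>vars\<close>.\<close>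

lemma eval_two_element_semilattice:
  assumes "s a a = a" and "s a c = c" and "s c a = c" and "s c c = c"
  shows "eval s (\<lambda>j. if j = i then a else c) t = (if vars t \<subseteq> {i} then a else c)"
  by (induction t) (simp_all add: assms)

lemma partial_semilattice_op_two_element_semilattice:
  assumes "partial_semilattice_op s" and "\<not> projection s"
  obtains a c where "a \<noteq> c" and "s a a = a" and "s a c = c" and "s c a = c" and "s c c = c"
proof -
  obtain a b where "s a b \<noteq> a"
    using assms(2) unfolding projection_def by blast
  then show thesis
    \<comment> \<open>With \<open>c = s a b\<close>, the two mixed products are the defining
      identities at \<open>a\<close> and \<open>b\<close>; the squares are idempotence.\<close>
    using that[of a "s a b"] assms(1) unfolding partial_semilattice_op_def by metis
qed

theorem corollary5:
  fixes s :: "'a \<Rightarrow> 'a \<Rightarrow> 'a" and e :: identity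
  assumes "partial_semilattice_op s"
    and "\<not> projection s"
    and "absorption_identity e"
    and "satisfies s e"
  shows "follows_from_idempotence TYPE('b) e"
proof -
  obtain t i where e: "e = (t \<approx> Var i)"
    using assms(3) unfolding absorption_identity_def by blast
  obtain a c where ac: "a \<noteq> c" "s a a = a" "s a c = c" "s c a = c" "s c c = c"
    using partial_semilattice_op_two_element_semilattice[OF assms(1,2)] .
  have "eval s (\<lambda>j. if j = i then a else c) t = a"
    using assms(4) unfolding e by simp
  then have "vars t \<subseteq> {i}"
    using ac(1) eval_two_element_semilattice[of s a c i t, OF ac(2-5)] by (auto split: if_splits)
  \<comment> \<open>The inclusion concerns the term alone, so it carries over from \<open>'a\<close>
    to any idempotent operation on \<open>'b\<close>.\<close>
  then show ?thesis
    unfolding follows_from_idempotence_def consequence_def satisfies_idempotence_iff e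
    by (simp add: eval_idempotent)
qed

end
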